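(* Let $(x^k)_{k\in\mathbb{N}}$ and $(\alpha_k)_{k\in\mathbb{N}}$ be the sequences generated by Method 3. Suppose that $S_*\neq\emptyset$ and that there is $\alpha>0$ such that $\alpha_k\ge\alpha$ for all $k\in\mathbb{N}$. Then for every $x_*\in S_*$ and all $k\in\mathbb{N}$, $$(f+g)(x^k)-\min_{x\in\mathcal{H}}(f+g)(x)\le\frac{\frac{2}{\alpha}\Big(\|x^0-x_*\|^2+2\sigma\big[(f+g)(x^0)-\min_{x\in\mathcal{H}}(f+g)(x)\big]\Big)}{(k+1)^2}.$$
   Context: Let $\mathcal{H}$ be a real Hilbert space with inner product $\langle\cdot,\cdot\rangle$ and induced norm $\|\cdot\|$; $\overline{\mathbb{R}}:=\mathbb{R}\cup\{+\infty\}$ and $\operatorname{dom}h:=\{x\in\mathcal{H}: h(x)<+\infty\}$. Standing assumptions. (A1) $f,g:\mathcal{H}\to\overline{\mathbb{R}}$ are proper lower semicontinuous convex functions with $\operatorname{dom}g\subseteq\operatorname{dom}f$. (A2) $f$ is Fréchet differentiable on an open set containing $\operatorname{dom}g$; its gradient $\nabla f$ is uniformly continuous on any bounded subset of $\operatorname{dom}g$ and maps any bounded subset of $\operatorname{dom}g$ to a bounded set in $\mathcal{H}$. In addition, $\Omega:=\operatorname{dom}g$ is closed; $P_\Omega$ is the orthogonal (nearest-point) projection onto $\Omega$. $S_*$ denotes the set of minimizers of $f+g$ over $\mathcal{H}$. The proximal operator is $\operatorname{prox}_{\alpha g}:=(\mathrm{Id}+\alpha\,\partial g)^{-1}$, which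 is single-valued and defined on all of $\mathcal{H}$ with values in $\operatorname{dom}g$. For $x\in\operatorname{dom}g$ and $\alpha>0$, $J(x,\alpha):=\operatorname{prox}_{\alpha g}(x-\alpha\nabla f(x))$. Linesearch 1 $(x,\sigma,\theta,\delta)$, for $x\in\operatorname{dom}g$, $\sigma>0$, $\theta\in(0,1)$, $\delta\in(0,1/2)$: set $\alpha=\sigma$; while $\alpha\|\nabla f(J(x,\alpha))-\nabla f(x)\|>\delta\|J(x,\alpha)-x\|$, replace $\alpha$ by $\theta\alpha$; output $\alpha$. Method 3: choose $x^{-1}=x^0\in\operatorname{dom}g$, $t_0=1$, $\theta\in(0,1)$, $\alpha_{-1}=\sigma>0$, $\delta\in(0,1/2)$. For $k=0,1,2,\dots$ set $$t_{k+1}=\frac{1+\sqrt{1+4t_k^2}}{2},\quad y^k=x^k+\Big(\frac{t_k-1}{t_{k+1}}\Big)(x^k-x^{k-1}),\quad \tilde y^k=P_\Omega(y^k),\quad x^{k+1}=J(\tilde y^k,\alpha_k),$$ where $\alpha_k$ is the output of Linesearch 1 $(\tilde y^k,\alpha_{k-1},\theta,\delta)$; the stop criterion is $x^{k+1}=\tilde y^k$. The statement concerns the infinite sequences $(x^k)_{k\in\mathbb{N}}$, $(\alpha_k)_{k\in\mathbb{N}}$ so generated. *)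

theory Defs
  imports "HOL-Analysis.Analysis" "HOL-Library.While_Combinator"
begin

text \<open>
  Functions into the real line extended by plus infinity are functions into \<^typ>\<open>ereal\<close>;
  the value minus infinity is excluded by \<open>proper_fun\<close>.
\<close>

definition edom :: "('a \<Rightarrow> ereal) \<Rightarrow> 'a set" where
  "edom h = {x. h x < \<infinity>}"

definition proper_fun :: "('a \<Rightarrow> ereal) \<Rightarrow> bool" where
  "proper_fun h \<longleftrightarrow> (\<forall>x. h x \<noteq> -\<infinity>) \<and> edom h \<noteq> {}"

definition lsc_fun :: "('a::topological_space \<Rightarrow> ereal) \<Rightarrow> bool" where
  "lsc_fun h \<longleftrightarrow> (\<forall>x. h x \<le> Liminf (nhds x) h)"

definition convex_fun :: "('a::real_vector \<Rightarrow> ereal) \<Rightarrow> bool" where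
  "convex_fun h \<longleftrightarrow>
     (\<forall>x y. \<forall>t\<in>{0<..<1}.
        h ((1 - t) *\<^sub>R x + t *\<^sub>R y) \<le> ereal (1 - t) * h x + ereal t * h y)"

definition minimizers :: "('a \<Rightarrow> ereal) \<Rightarrow> 'a set" where
  "minimizers h = {x. \<forall>y. h x \<le> h y}"

text \<open>
  Since \<^const>\<open>real_of_ereal\<close> sends infinity to 0, the following two notions of differential
  calculus are only meaningful at points in whose neighbourhood the function is finite;
  \<open>frechet_differentiable_on\<close> therefore demands finiteness on the (open) set.
\<close>

definition frechet_differentiable_on ::
    "('a::real_normed_vector \<Rightarrow> ereal) \<Rightarrow> 'a set \<Rightarrow> bool" where
  "frechet_differentiable_on h U \<longleftrightarrow>
     open U \<and> (\<forall>x\<in>U. \<bar>h x\<bar> \<noteq> \<infinity>) \<and>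
     (\<forall>x\<in>U. (\<lambda>y. real_of_ereal (h y)) differentiable (at x))"

definition grad :: "('a::real_inner \<Rightarrow> ereal) \<Rightarrow> 'a \<Rightarrow> 'a" where
  "grad h x = (THE D. GDERIV (\<lambda>y. real_of_ereal (h y)) x :> D)"

text \<open>For proper \<open>h\<close> the subdifferential is empty at every point outside \<open>edom h\<close>.\<close>

definition subdifferential :: "('a::real_inner \<Rightarrow> ereal) \<Rightarrow> 'a \<Rightarrow> 'a set" where
  "subdifferential h x = {v. \<forall>y. h x + ereal (inner v (y - x)) \<le> h y}"

text \<open>The value at \<open>z\<close> of the inverse of the set-valued operator \<open>Id + a \<partial>h\<close>.\<close>

definition prox :: "real \<Rightarrow> ('a::real_inner \<Rightarrow> ereal) \<Rightarrow> 'a \<Rightarrow> 'a" where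
  "prox a h z = (THE p. z \<in> {p + a *\<^sub>R v | v. v \<in> subdifferential h p})"

text \<open>
  The library's \<open>closest_point\<close> is confined to Heine-Borel spaces, hence to finite dimension.
\<close>

definition projection :: "'a::real_inner set \<Rightarrow> 'a \<Rightarrow> 'a" where
  "projection S z = (THE p. p \<in> S \<and> (\<forall>y\<in>S. dist z p \<le> dist z y))"

definition fb_step ::
    "('a::real_inner \<Rightarrow> ereal) \<Rightarrow> ('a \<Rightarrow> ereal) \<Rightarrow> 'a \<Rightarrow> real \<Rightarrow> 'a" where
  "fb_step f g x a = prox a g (x - a *\<^sub>R grad f x)"

text \<open>The result is \<^const>\<open>None\<close> if the loop does not terminate.\<close>

definition linesearch1 ::
    "('a::real_inner \<Rightarrow> ereal) \<Rightarrow> ('a \<Rightarrow> ereal) \<Rightarrow> 'a \<Rightarrow> real \<Rightarrow> real \<Rightarrow> real \<Rightarrow> real option" where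
  "linesearch1 f g x \<sigma> \<theta> \<delta> =
     while_option
       (\<lambda>a. a * norm (grad f (fb_step f g x a) - grad f x) > \<delta> * norm (fb_step f g x a - x))
       (\<lambda>a. \<theta> * a) \<sigma>"

primrec t_seq :: "nat \<Rightarrow> real" where
  "t_seq 0 = 1"
| "t_seq (Suc k) = (1 + sqrt (1 + 4 * (t_seq k)\<^sup>2)) / 2"

definition extrapolated :: "(nat \<Rightarrow> 'a::real_vector) \<Rightarrow> nat \<Rightarrow> 'a" where
  "extrapolated x k =
     x k + ((t_seq k - 1) / t_seq (Suc k)) *\<^sub>R (x k - (case k of 0 \<Rightarrow> x 0 | Suc j \<Rightarrow> x j))"

text \<open>
  The initial values with index \<open>-1\<close>, namely \<open>x 0\<close> for the iterates and \<open>\<sigma>\<close> for the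
  stepsizes, appear as the zero cases of the case distinctions. The stop criterion
  \<open>x (Suc k) = projection (edom g) (extrapolated x k)\<close> is not made part of the predicate: the
  infinite sequences along which it never holds satisfy the predicate, and so do those which
  are continued by the same recursion after it has been met.
\<close>

definition method3 ::
    "('a::real_inner \<Rightarrow> ereal) \<Rightarrow> ('a \<Rightarrow> ereal) \<Rightarrow> real \<Rightarrow> real \<Rightarrow> real \<Rightarrow>
     (nat \<Rightarrow> 'a) \<Rightarrow> (nat \<Rightarrow> real) \<Rightarrow> bool" where
  "method3 f g \<sigma> \<theta> \<delta> x \<alpha> \<longleftrightarrow>
     x 0 \<in> edom g \<and> \<sigma> > 0 \<and> \<theta> \<in> {0<..<1} \<and> \<delta> \<in> {0<..<1/2} \<and>
     (\<forall>k. let y' = projection (edom g) (extrapolated x k);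
              \<alpha>' = (case k of 0 \<Rightarrow> \<sigma> | Suc j \<Rightarrow> \<alpha> j)
          in linesearch1 f g y' \<alpha>' \<theta> \<delta> = Some (\<alpha> k) \<and>
             x (Suc k) = fb_step f g y' (\<alpha> k))"

end

theory Submission
  imports Defs
begin

text \<open>
  The linesearch condition turns the proximal-gradient step \<open>J\<close> from \<open>x\<close> into the descent inequality
  \<open>2 a (F J - F y) \<le> \<parallel>x - y\<parallel>\<^sup>2 - \<parallel>J - y\<parallel>\<^sup>2\<close> for all \<open>y\<close> in the domain, with \<open>F = f + g\<close>.
  Using it at \<open>y = (1 - 1/t) x\<^sub>k + (1/t) x\<^sub>*\<close> with \<open>t = t\<^sub>k\<^sub>+\<^sub>1\<close>, where projecting the extrapolated point
  only decreases the distance to \<open>y\<close>, shows that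
  \<open>\<parallel>t\<^sub>k x\<^sub>k - (t\<^sub>k - 1) x\<^sub>k\<^sub>-\<^sub>1 - x\<^sub>*\<parallel>\<^sup>2 + 2 \<alpha>\<^sub>k\<^sub>-\<^sub>1 t\<^sub>k\<^sup>2 (F x\<^sub>k - F x\<^sub>*)\<close> does not increase; the rate
  follows from \<open>t\<^sub>k \<ge> (k + 2)/2\<close>.
  The proximal point of a lower semicontinuous convex function exists because minimizing sequences
  of the strongly convex regularized problem are Cauchy. Projections onto closed convex sets and
  Riesz representatives are the instances for indicator functions and linear functionals.
\<close>

section \<open>Convex functions with extended real values\<close>

text \<open>Let t tend to 0 from the right; this closes a first-order optimality argument along a
  segment.\<close>

lemma nonneg_of_perturbation:
  fixes A B :: real
  assumes "\<And>t. 0 < t \<Longrightarrow> t < 1 \<Longrightarrow> 0 \<le> A + t * B"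
  shows "0 \<le> A"
proof (rule tendsto_lowerbound)
  show "((\<lambda>t. A + t * B) \<longlongrightarrow> A) (at_right 0)"
    by (auto intro!: tendsto_eq_intros)
  show "\<forall>\<^sub>F t in at_right 0. 0 \<le> A + t * B"
    unfolding eventually_at_right_field using assms by (intro exI[of _ 1]) auto
qed simp

lemma proper_fun_ereal_real:
  assumes "proper_fun h" "x \<in> edom h"
  shows "h x = ereal (real_of_ereal (h x))"
  using assms by (cases "h x") (auto simp: proper_fun_def edom_def)

lemma convex_fun_real:
  assumes h: "proper_fun h" "convex_fun h" and xy: "x \<in> edom h" "y \<in> edom h"
    and t: "0 \<le> t" "t \<le> 1"
  shows "(1 - t) *\<^sub>R x + t *\<^sub>R y \<in> edom h"
    and "real_of_ereal (h ((1 - t) *\<^sub>R x + t *\<^sub>R y))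
      \<le> (1 - t) * real_of_ereal (h x) + t * real_of_ereal (h y)"
proof -
  let ?z = "(1 - t) *\<^sub>R x + t *\<^sub>R y"
  have "?z \<in> edom h \<and> real_of_ereal (h ?z) \<le> (1 - t) * real_of_ereal (h x) + t * real_of_ereal (h y)"
  \<comment> \<open>The definition of convexity covers only the open interval; at its endpoints the
    combination is \<open>x\<close> or \<open>y\<close> itself.\<close>
  proof (cases "t = 0 \<or> t = 1")
    case True
    then show ?thesis using xy by auto
  next
    case False
    then have "t \<in> {0<..<1}" using t by auto
    then have "h ?z \<le> ereal (1 - t) * h x + ereal t * h y"
      using h(2) unfolding convex_fun_def by blast
    also have "\<dots> = ereal (1 - t) * ereal (real_of_ereal (h x)) + ereal t * ereal (real_of_ereal (h y))"
      using proper_fun_ereal_real[OF h(1)] xy by metis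
    finally have le: "h ?z \<le> ereal ((1 - t) * real_of_ereal (h x) + t * real_of_ereal (h y))"
      by simp
    then have z: "?z \<in> edom h"
      unfolding edom_def using le_less_trans by fastforce
    show ?thesis
      using z le proper_fun_ereal_real[OF h(1) z] by (metis ereal_less_eq(3))
  qed
  then show "?z \<in> edom h"
    and "real_of_ereal (h ?z) \<le> (1 - t) * real_of_ereal (h x) + t * real_of_ereal (h y)"
    by auto
qed

lemma lsc_fun_eventually:
  assumes "lsc_fun h" "ereal c < h x"
  shows "\<forall>\<^sub>F y in nhds x. ereal c < h y"
  using assms less_LiminfD order_less_le_trans unfolding lsc_fun_def by blast

text \<open>Lower semicontinuity bounds \<open>h\<close> below on a small ball around a point of its domain, and
  convexity propagates that bound linearly along rays.\<close>

lemma convex_lsc_norm_minorant: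
  fixes h :: "'a::real_normed_vector \<Rightarrow> ereal"
  assumes h: "proper_fun h" "lsc_fun h" "convex_fun h"
  obtains b c where "c \<ge> 0" "\<And>y. y \<in> edom h \<Longrightarrow> b - c * norm y \<le> real_of_ereal (h y)"
proof -
  obtain w where w: "w \<in> edom h" using h(1) unfolding proper_fun_def by auto
  define r where "r = (\<lambda>y. real_of_ereal (h y))"
  have hr: "h y = ereal (r y)" if "y \<in> edom h" for y
    using proper_fun_ereal_real[OF h(1) that] by (simp add: r_def)
  have "ereal (r w - 1) < h w" using hr[OF w] by simp
  from lsc_fun_eventually[OF h(2) this] obtain d where d: "d > 0"
    and d': "\<And>y. dist y w < d \<Longrightarrow> ereal (r w - 1) < h y"
    unfolding eventually_nhds_metric by auto
  have bound: "r w - 1 - (2 / d) * norm (y - w) \<le> r y" if y: "y \<in> edom h" for y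
  proof (cases "dist y w < d")
    case True
    from d'[OF True] have "r w - 1 < r y" using hr[OF y] by simp
    moreover have "0 \<le> (2 / d) * norm (y - w)" using d by simp
    ultimately show ?thesis by linarith
  next
    case False
    define n where "n = norm (y - w)"
    have n: "n \<ge> d" using False by (simp add: n_def dist_norm)
    \<comment> \<open>This weight puts \<open>u\<close> on the segment from \<open>w\<close> to
      \<open>y\<close> at distance d/2 from \<open>w\<close>, inside the ball, and makes 1 / t
      linear in \<open>n\<close>.\<close>
    define t where "t = d / (2 * n)"
    have t: "0 < t" "t \<le> 1" using n d by (auto simp: t_def field_simps)
    define u where "u = (1 - t) *\<^sub>R w + t *\<^sub>R y"
    have u: "u \<in> edom h" "r u \<le> (1 - t) * r w + t * r y"
      using convex_fun_real[OF h(1,3) w y] t by (auto simp: u_def r_def)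
    have "u - w = t *\<^sub>R (y - w)" by (simp add: u_def algebra_simps)
    then have "dist u w = t * n" using t by (simp add: dist_norm n_def)
    also have "\<dots> = d / 2" using n d by (simp add: t_def)
    finally have "r w - 1 < r u" using d'[of u] d hr[OF u(1)] by simp
    then have "t * (r w - r y) < 1" using u(2) by (simp add: algebra_simps)
    then have "r w - r y < 1 / t" using t by (simp add: field_simps)
    also have "1 / t = (2 / d) * n" using n d by (simp add: t_def)
    finally show ?thesis by (simp add: n_def)
  qed
  show thesis
  proof (rule that)
    show "0 \<le> 2 / d" using d by simp
    fix y assume y: "y \<in> edom h"
    have "(2 / d) * norm (y - w) \<le> (2 / d) * (norm y + norm w)"
      using d by (intro mult_left_mono norm_triangle_ineq4) auto
    then have "(2 / d) * norm (y - w) \<le> (2 / d) * norm y + (2 / d) * norm w"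
      by (simp only: distrib_left)
    with bound[OF y]
    show "(r w - 1 - (2 / d) * norm w) - (2 / d) * norm y \<le> real_of_ereal (h y)"
      unfolding r_def by linarith
  qed
qed

section \<open>Proximal points and resolvents\<close>

text \<open>The parallelogram law for x - z and y - z.\<close>

lemma norm_midpoint_diff:
  fixes x y z :: "'a::real_inner"
  shows "(norm ((1/2) *\<^sub>R x + (1/2) *\<^sub>R y - z))\<^sup>2
    = ((norm (x - z))\<^sup>2 + (norm (y - z))\<^sup>2) / 2 - (norm (x - y))\<^sup>2 / 4"
proof -
  have "(1/2) *\<^sub>R x + (1/2) *\<^sub>R y - z = (1/2) *\<^sub>R (x - z) + (1/2) *\<^sub>R (y - z)"
    by (simp add: algebra_simps flip: scaleR_add_left)
  moreover have "x - y = (x - z) - (y - z)" by simp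
  ultimately show ?thesis
    by (simp only: power2_norm_eq_inner)
       (simp add: algebra_simps inner_commute field_simps)
qed

lemma prox_minimizer_exists:
  fixes h :: "'a::{real_inner, complete_space} \<Rightarrow> ereal"
  assumes h: "proper_fun h" "lsc_fun h" "convex_fun h" and a: "a > 0"
  obtains p where "p \<in> edom h"
    "\<And>y. y \<in> edom h \<Longrightarrow> real_of_ereal (h p) + (norm (p - z))\<^sup>2 / (2 * a)
       \<le> real_of_ereal (h y) + (norm (y - z))\<^sup>2 / (2 * a)"
proof -
  define r where "r = (\<lambda>y. real_of_ereal (h y))"
  define q where "q = (\<lambda>y. r y + (norm (y - z))\<^sup>2 / (2 * a))"
  have hr: "h y = ereal (r y)" if "y \<in> edom h" for y
    using proper_fun_ereal_real[OF h(1) that] by (simp add: r_def)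
  have ne: "edom h \<noteq> {}" using h(1) by (simp add: proper_fun_def)
  obtain b c where c: "c \<ge> 0" and bc: "\<And>y. y \<in> edom h \<Longrightarrow> b - c * norm y \<le> r y"
    using convex_lsc_norm_minorant[OF h] unfolding r_def by metis
  have "b - c * norm z - a * c\<^sup>2 / 2 \<le> q y" if y: "y \<in> edom h" for y
  proof -
    define s where "s = norm (y - z)"
    have "norm y \<le> norm z + s" unfolding s_def by (metis add.commute norm_triangle_sub)
    then have "c * norm y \<le> c * (norm z + s)" using c by (rule mult_left_mono)
    \<comment> \<open>Completing the square: the quadratic term absorbs the linear loss c * s up to
      the constant \<open>a * c\<^sup>2 / 2\<close>.\<close>
    moreover have "0 \<le> (s - a * c)\<^sup>2 / (2 * a)" using a by simp
    then have "c * s - a * c\<^sup>2 / 2 \<le> s\<^sup>2 / (2 * a)"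
      using a by (simp add: field_simps power2_eq_square)
    ultimately show ?thesis using bc[OF y] by (simp add: q_def s_def algebra_simps)
  qed
  then have bdd: "bdd_below (q ` edom h)" by (intro bdd_belowI2)
  define m where "m = Inf (q ` edom h)"
  have m_le: "m \<le> q y" if "y \<in> edom h" for y
    unfolding m_def using bdd that by (intro cInf_lower) auto
  have "\<exists>y\<in>edom h. q y < m + inverse (real (Suc n))" for n
    using cInf_less_iff[OF _ bdd, of "m + inverse (real (Suc n))"] ne by (auto simp: m_def)
  then obtain X where X: "\<And>n. X n \<in> edom h" "\<And>n. q (X n) < m + inverse (real (Suc n))"
    by metis
  \<comment> \<open>Strong convexity: the value at the midpoint is at least \<open>m\<close>, yet it
    lies below the average of the values at \<open>u\<close> and \<open>v\<close> by a multiple of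
    their squared distance.\<close>
  have close: "(norm (u - v))\<^sup>2 \<le> 4 * a * ((q u - m) + (q v - m))"
    if uv: "u \<in> edom h" "v \<in> edom h" for u v
  proof -
    define w where "w = (1/2) *\<^sub>R u + (1/2) *\<^sub>R v"
    have w: "w \<in> edom h" "2 * r w \<le> r u + r v"
      using convex_fun_real[OF h(1,3) uv, of "1/2"] by (auto simp: r_def w_def)
    define N where "N = (\<lambda>y. (norm (y - z))\<^sup>2 / (2 * a))"
    have "2 * N w = N u + N v - (norm (u - v))\<^sup>2 / (4 * a)"
      unfolding N_def w_def norm_midpoint_diff using a by (simp add: field_simps)
    moreover have "q = (\<lambda>y. r y + N y)" by (simp add: q_def N_def)
    ultimately have "2 * q w \<le> q u + q v - (norm (u - v))\<^sup>2 / (4 * a)"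
      using w(2) by simp
    then have "(norm (u - v))\<^sup>2 / (4 * a) \<le> (q u - m) + (q v - m)"
      using m_le[OF w(1)] by simp
    then show ?thesis using a by (simp add: field_simps)
  qed
  have "Cauchy X"
  proof (rule metric_CauchyI)
    fix e :: real assume e: "e > 0"
    \<comment> \<open>The factor 8 * a makes two excesses below this threshold contribute less than
      \<open>e\<^sup>2\<close> in \<open>close\<close>.\<close>
    then obtain N where N: "inverse (real (Suc N)) < e\<^sup>2 / (8 * a)"
      using reals_Archimedean[of "e\<^sup>2 / (8 * a)"] a by auto
    have small: "q (X n) - m < e\<^sup>2 / (8 * a)" if "n \<ge> N" for n
    proof -
      have "inverse (real (Suc n)) \<le> inverse (real (Suc N))" using that by simp
      then show ?thesis using X(2)[of n] N by linarith
    qed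
    have "dist (X i) (X j) < e" if ij: "i \<ge> N" "j \<ge> N" for i j
    proof -
      have "(norm (X i - X j))\<^sup>2 \<le> 4 * a * ((q (X i) - m) + (q (X j) - m))"
        using close X(1) by blast
      also have "\<dots> < 4 * a * (e\<^sup>2 / (8 * a) + e\<^sup>2 / (8 * a))"
        using small[OF ij(1)] small[OF ij(2)] a by (intro mult_strict_left_mono) auto
      also have "\<dots> = e\<^sup>2" using a by (simp add: field_simps)
      finally show ?thesis using e by (simp add: dist_norm power2_less_imp_less)
    qed
    then show "\<exists>M. \<forall>i\<ge>M. \<forall>j\<ge>M. dist (X i) (X j) < e" by blast
  qed
  then obtain p where p: "X \<longlonglongrightarrow> p" using Cauchy_convergent convergent_def by blast
  let ?lim = "m - (norm (p - z))\<^sup>2 / (2 * a)"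
  have lim: "(\<lambda>n. m + inverse (real (Suc n)) - (norm (X n - z))\<^sup>2 / (2 * a)) \<longlonglongrightarrow> ?lim"
  proof -
    have "(\<lambda>n. (norm (X n - z))\<^sup>2 / (2 * a)) \<longlonglongrightarrow> (norm (p - z))\<^sup>2 / (2 * a)"
      using p a by (auto intro!: tendsto_intros)
    from tendsto_diff[OF tendsto_add[OF tendsto_const LIMSEQ_inverse_real_of_nat] this, of m]
    show ?thesis by simp
  qed
  \<comment> \<open>Finiteness at \<open>p\<close> is still open, so the argument stays in the
    extended reals: otherwise lower semicontinuity puts some C above \<open>?lim\<close> eventually
    below \<open>h (X n)\<close>, hence below upper bounds that converge to
    \<open>?lim\<close>.\<close>
  have hp: "h p \<le> ereal ?lim"
  proof (rule ccontr)
    assume "\<not> h p \<le> ereal ?lim"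
    then obtain C where C: "ereal ?lim < ereal C" "ereal C < h p"
      using ereal_dense2 not_le by metis
    have "\<forall>\<^sub>F n in sequentially. ereal C < h (X n)"
      using lsc_fun_eventually[OF h(2) C(2)] p by (rule eventually_compose_filterlim)
    then have "\<forall>\<^sub>F n in sequentially.
        C \<le> m + inverse (real (Suc n)) - (norm (X n - z))\<^sup>2 / (2 * a)"
    proof eventually_elim
      case (elim n)
      then have "C < r (X n)" using hr[OF X(1)] by simp
      then show ?case using X(2)[of n] by (simp add: q_def)
    qed
    from tendsto_lowerbound[OF lim this] C(1) show False by simp
  qed
  then have pD: "p \<in> edom h" unfolding edom_def using le_less_trans by fastforce
  have "q p \<le> m" using hp hr[OF pD] by (simp add: q_def)
  with m_le pD show thesis by (intro that[of p]) (force simp: q_def r_def)+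
qed

text \<open>Test the subgradient inequality at a point where \<open>h\<close> is finite.\<close>

lemma subdifferential_edom:
  assumes "proper_fun h" "v \<in> subdifferential h p"
  shows "p \<in> edom h"
proof -
  obtain w where w: "w \<in> edom h" using assms(1) unfolding proper_fun_def by auto
  have "h p + ereal (inner v (w - p)) \<le> h w"
    using assms(2) by (simp add: subdifferential_def)
  with w show ?thesis by (auto simp: edom_def)
qed

lemma subdifferentialD_real:
  assumes "proper_fun h" "v \<in> subdifferential h p" "y \<in> edom h"
  shows "real_of_ereal (h p) + inner v (y - p) \<le> real_of_ereal (h y)"
proof -
  have "h p + ereal (inner v (y - p)) \<le> h y"
    using assms(2) by (simp add: subdifferential_def)
  then show ?thesis
    using proper_fun_ereal_real[OF assms(1,3)]
      proper_fun_ereal_real[OF assms(1) subdifferential_edom[OF assms(1,2)]]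
    by (metis ereal_less_eq(3) plus_ereal.simps(1))
qed

text \<open>Fermat's rule for the proximal minimizer: compare \<open>p\<close> with points of the
  segment towards \<open>y\<close>, divide by t and let t tend to 0.\<close>

lemma resolvent_exists:
  fixes h :: "'a::{real_inner, complete_space} \<Rightarrow> ereal"
  assumes h: "proper_fun h" "lsc_fun h" "convex_fun h" and a: "a > 0"
  obtains p v where "v \<in> subdifferential h p" "z = p + a *\<^sub>R v"
proof -
  obtain p where p: "p \<in> edom h" and
    min: "\<And>y. y \<in> edom h \<Longrightarrow> real_of_ereal (h p) + (norm (p - z))\<^sup>2 / (2 * a)
       \<le> real_of_ereal (h y) + (norm (y - z))\<^sup>2 / (2 * a)"
    using prox_minimizer_exists[OF h a, of z] by metis
  define v where "v = (1 / a) *\<^sub>R (z - p)"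
  have "h p + ereal (inner v (y - p)) \<le> h y" for y
  proof (cases "y \<in> edom h")
    case y: True
    \<comment> \<open>The slack of the subgradient inequality at \<open>y\<close>; minimality of
      \<open>p\<close> makes it nonnegative up to a term of order t.\<close>
    define A where "A = real_of_ereal (h y) - real_of_ereal (h p) - inner v (y - p)"
    have "0 \<le> A + t * ((norm (y - p))\<^sup>2 / (2 * a))" if t: "0 < t" "t < 1" for t
    proof -
      let ?u = "(1 - t) *\<^sub>R p + t *\<^sub>R y"
      have u: "?u \<in> edom h"
        "real_of_ereal (h ?u) \<le> (1 - t) * real_of_ereal (h p) + t * real_of_ereal (h y)"
        using convex_fun_real[OF h(1,3) p y, of t] t by auto
      have "?u - z = (p - z) + t *\<^sub>R (y - p)" by (simp add: algebra_simps)
      then have "(norm (?u - z))\<^sup>2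
          = (norm (p - z))\<^sup>2 + 2 * t * inner (p - z) (y - p) + t\<^sup>2 * (norm (y - p))\<^sup>2"
        by (simp only: power2_norm_eq_inner inner_add_left inner_add_right inner_scaleR_left
            inner_scaleR_right inner_commute[of "y - p" "p - z"]) (simp add: power2_eq_square algebra_simps)
      moreover have "inner (p - z) (y - p) = - a * inner v (y - p)"
        using a by (simp add: v_def inner_diff_left algebra_simps)
      ultimately have "(norm (?u - z))\<^sup>2 / (2 * a) = (norm (p - z))\<^sup>2 / (2 * a)
          - t * inner v (y - p) + t * (t * ((norm (y - p))\<^sup>2 / (2 * a)))"
        using a by (simp add: field_simps power2_eq_square)
      with min[OF u(1)] u(2) have "0 \<le> t * (A + t * ((norm (y - p))\<^sup>2 / (2 * a)))"
        by (simp add: A_def algebra_simps)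
      then show ?thesis using t by (simp add: zero_le_mult_iff)
    qed
    then have "0 \<le> A" by (rule nonneg_of_perturbation)
    then have "ereal (real_of_ereal (h p)) + ereal (inner v (y - p)) \<le> ereal (real_of_ereal (h y))"
      by (simp add: A_def)
    then show ?thesis
      using proper_fun_ereal_real[OF h(1)] p y by metis
  qed (auto simp: edom_def)
  then have "v \<in> subdifferential h p" by (simp add: subdifferential_def)
  moreover have "z = p + a *\<^sub>R v" using a by (simp add: v_def)
  ultimately show thesis by (rule that)
qed

text \<open>Add the two subgradient inequalities, each tested at the base point of the
  other.\<close>

lemma subdifferential_monotone:
  assumes h: "proper_fun h" and v: "v \<in> subdifferential h p" and w: "w \<in> subdifferential h q"
  shows "0 \<le> inner (v - w) (p - q)"
  using subdifferentialD_real[OF h v subdifferential_edom[OF h w]]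
    subdifferentialD_real[OF h w subdifferential_edom[OF h v]]
  by (simp add: algebra_simps)

text \<open>Gives meaning to the definite description in \<open>prox\<close>: a solution exists by
  the previous construction, and monotonicity forces the squared distance of two solutions to be at
  most 0.\<close>

lemma prox_resolvent:
  fixes h :: "'a::{real_inner, complete_space} \<Rightarrow> ereal"
  assumes h: "proper_fun h" "lsc_fun h" "convex_fun h" and a: "a > 0"
  shows "(1 / a) *\<^sub>R (z - prox a h z) \<in> subdifferential h (prox a h z)"
proof -
  obtain p v where p: "v \<in> subdifferential h p" "z = p + a *\<^sub>R v"
    using resolvent_exists[OF h a] by blast
  have "prox a h z = p"
    unfolding prox_def
  proof (rule the_equality)
    show "z \<in> {p + a *\<^sub>R v | v. v \<in> subdifferential h p}" using p by auto
    fix q assume "z \<in> {q + a *\<^sub>R v | v. v \<in> subdifferential h q}"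
    then obtain w where w: "w \<in> subdifferential h q" "z = q + a *\<^sub>R w" by auto
    have "q - p = a *\<^sub>R (v - w)" using p(2) w(2) by (simp add: algebra_simps)
    then have "inner (q - p) (q - p) = - a * inner (v - w) (p - q)"
      by (metis inner_minus_right inner_scaleR_left minus_diff_eq mult_minus_left mult_minus_right)
    also have "\<dots> \<le> 0"
      using subdifferential_monotone[OF h(1) p(1) w(1)] a by simp
    finally show "q = p" by (metis eq_iff_diff_eq_0 inner_gt_zero_iff not_le)
  qed
  then show ?thesis using p a by simp
qed

section \<open>Projection onto closed convex sets\<close>

lemma convex_edom:
  assumes "proper_fun h" "convex_fun h"
  shows "convex (edom h)"
  unfolding convex_alt using convex_fun_real(1)[OF assms] by blast

text \<open>The resolvent with parameter 1 of the indicator function of \<open>S\<close> yields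
  \<open>p\<close> with z - p in the normal cone of \<open>S\<close> at \<open>p\<close>; this
  obtuse-angle condition identifies \<open>p\<close> as the unique nearest point.\<close>

lemma projection_variational:
  fixes S :: "'a::{real_inner, complete_space} set"
  assumes S: "closed S" "convex S" "S \<noteq> {}"
  shows "projection S z \<in> S"
    and "y \<in> S \<Longrightarrow> inner (z - projection S z) (y - projection S z) \<le> 0"
proof -
  define h where "h = (\<lambda>x. if x \<in> S then 0 else \<infinity> :: ereal)"
  have dom: "edom h = S" by (auto simp: edom_def h_def)
  have h: "proper_fun h" using S(3) dom by (auto simp: proper_fun_def h_def)
  have "convex_fun h"
    unfolding convex_fun_def
  proof (intro allI ballI)
    fix x y :: 'a and t :: real assume t: "t \<in> {0<..<1}"
    show "h ((1 - t) *\<^sub>R x + t *\<^sub>R y) \<le> ereal (1 - t) * h x + ereal t * h y"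
    proof (cases "x \<in> S \<and> y \<in> S")
      case True
      then have "(1 - t) *\<^sub>R x + t *\<^sub>R y \<in> S" using S(2) t by (simp add: convex_alt)
      then show ?thesis using True by (simp add: h_def)
    next
      case False
      then show ?thesis using t by (auto simp: h_def)
    qed
  qed
  moreover have "lsc_fun h"
    unfolding lsc_fun_def
  proof
    fix x show "h x \<le> Liminf (nhds x) h"
    proof (cases "x \<in> S")
      case True
      then show ?thesis by (auto simp: h_def intro!: Liminf_bounded always_eventually)
    next
      case False
      then have "\<forall>\<^sub>F y in nhds x. y \<in> - S"
        using S(1) by (intro eventually_nhds_in_open) auto
      then have "\<forall>\<^sub>F y in nhds x. h x \<le> h y" by eventually_elim (auto simp: h_def)
      then show ?thesis by (rule Liminf_bounded)
    qed
  qed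
  ultimately obtain p v where v: "v \<in> subdifferential h p" "z = p + 1 *\<^sub>R v"
    using resolvent_exists[OF h, of 1] by (metis zero_less_one)
  have p: "p \<in> S" using subdifferential_edom[OF h v(1)] dom by simp
  have var: "inner (z - p) (y - p) \<le> 0" if "y \<in> S" for y
    using subdifferentialD_real[OF h v(1), of y] that p v(2) dom by (simp add: h_def)
  \<comment> \<open>The extra term \<open>(dist p y)\<^sup>2\<close> gives uniqueness of the nearest
    point besides minimality.\<close>
  have pyth: "(dist z p)\<^sup>2 + (dist p y)\<^sup>2 \<le> (dist z y)\<^sup>2" if "y \<in> S" for y
  proof -
    have "(dist z y)\<^sup>2 = (dist z p)\<^sup>2 + (dist p y)\<^sup>2 - 2 * inner (z - p) (y - p)"
      unfolding dist_norm power2_norm_eq_inner by (simp add: algebra_simps inner_commute)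
    then show ?thesis using var[OF that] by simp
  qed
  have "projection S z = p"
    unfolding projection_def
  proof (rule the_equality)
    have "dist z p \<le> dist z y" if "y \<in> S" for y
    proof (rule power2_le_imp_le)
      show "(dist z p)\<^sup>2 \<le> (dist z y)\<^sup>2"
        using pyth[OF that] zero_le_power2[of "dist p y"] by linarith
    qed simp
    then show "p \<in> S \<and> (\<forall>y\<in>S. dist z p \<le> dist z y)" using p by blast
    fix q assume q: "q \<in> S \<and> (\<forall>y\<in>S. dist z q \<le> dist z y)"
    then have "(dist z q)\<^sup>2 \<le> (dist z p)\<^sup>2" using p by (simp add: power_mono)
    with pyth[of q] q have "(dist p q)\<^sup>2 \<le> 0" by (metis add_le_same_cancel1 order_trans)
    then show "q = p" by simp
  qed
  then show "projection S z \<in> S"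
    and "y \<in> S \<Longrightarrow> inner (z - projection S z) (y - projection S z) \<le> 0"
    using p var by auto
qed

text \<open>Law of cosines in the triangle with its obtuse angle at the projection.\<close>

lemma norm_projection_diff_le:
  fixes S :: "'a::{real_inner, complete_space} set"
  assumes S: "closed S" "convex S" and y: "y \<in> S"
  shows "norm (projection S z - y) \<le> norm (z - y)"
proof -
  let ?p = "projection S z"
  have "(norm (z - y))\<^sup>2 = (norm (z - ?p))\<^sup>2 + (norm (?p - y))\<^sup>2 - 2 * inner (z - ?p) (y - ?p)"
    unfolding power2_norm_eq_inner by (simp add: algebra_simps inner_commute)
  moreover have "inner (z - ?p) (y - ?p) \<le> 0"
    using projection_variational(2)[OF S _ y] y by blast
  ultimately have "(norm (?p - y))\<^sup>2 \<le> (norm (z - y))\<^sup>2"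
    using zero_le_power2[of "norm (z - ?p)"] by linarith
  then show ?thesis by (rule power2_le_imp_le) simp
qed

section \<open>Gradients and the gradient inequality\<close>

text \<open>The proximal point \<open>p\<close> of \<open>L\<close> at the origin has \<open>- p\<close> as a
  subgradient of \<open>L\<close>, and a subgradient of a linear functional represents it.\<close>

lemma riesz_representation:
  fixes L :: "'a::{real_inner, complete_space} \<Rightarrow> real"
  assumes L: "bounded_linear L"
  obtains D where "\<And>y. L y = inner D y"
proof -
  interpret bounded_linear L by fact
  define h where "h = (\<lambda>x. ereal (L x))"
  have h: "proper_fun h" by (auto simp: proper_fun_def edom_def h_def)
  have "convex_fun h" by (auto simp: convex_fun_def h_def add scale)
  moreover have "lsc_fun h"
    unfolding lsc_fun_def
  proof
    fix x
    have "(L \<longlongrightarrow> L x) (nhds x)"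
      using linear_continuous_at[OF L] by (simp add: isCont_def tendsto_at_iff_tendsto_nhds)
    then have "(h \<longlongrightarrow> h x) (nhds x)" by (simp add: h_def)
    then show "h x \<le> Liminf (nhds x) h"
      using lim_imp_Liminf[of "nhds x" h "h x"] by simp
  qed
  ultimately obtain p D where D: "D \<in> subdifferential h p"
    using resolvent_exists[OF h, of 1 0] by (metis zero_less_one)
  have le: "inner D y \<le> L y" for y
    using subdifferentialD_real[OF h D, of "p + y"] by (simp add: h_def edom_def add)
  have "L y = inner D y" for y
    using le[of y] le[of "- y"] by (simp add: neg)
  then show thesis by (rule that)
qed

text \<open>Gives meaning to the definite description in \<open>grad\<close>: Riesz representation
  supplies a vector, and testing two of them on their difference shows that they coincide.\<close>

lemma GDERIV_grad:
  fixes h :: "'a::{real_inner, complete_space} \<Rightarrow> ereal"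
  assumes "(\<lambda>y. real_of_ereal (h y)) differentiable (at x)"
  shows "GDERIV (\<lambda>y. real_of_ereal (h y)) x :> grad h x"
proof -
  obtain L where L: "((\<lambda>y. real_of_ereal (h y)) has_derivative L) (at x)"
    using assms by (auto simp: differentiable_def)
  obtain D where D: "\<And>y. L y = inner D y"
    using riesz_representation[OF has_derivative_bounded_linear[OF L]] by blast
  have "L = (\<lambda>y. inner y D)" using D by (auto simp: inner_commute)
  with L have G: "GDERIV (\<lambda>y. real_of_ereal (h y)) x :> D" by (simp add: gderiv_def)
  have "E = D" if "GDERIV (\<lambda>y. real_of_ereal (h y)) x :> E" for E
  proof -
    have "(\<lambda>y. inner y E) = (\<lambda>y. inner y D)"
      using has_derivative_unique that G unfolding gderiv_def by blast
    then have "inner (E - D) E = inner (E - D) D" by metis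
    then show ?thesis by (metis eq_iff_diff_eq_0 inner_diff_right inner_eq_zero_iff)
  qed
  with G show ?thesis unfolding grad_def by (metis theI)
qed

text \<open>Convexity bounds every difference quotient along the segment with 0 < t < 1 by the
  difference of the end values; its limit is the directional derivative.\<close>

lemma convex_gradient_inequality:
  fixes h :: "'a::{real_inner, complete_space} \<Rightarrow> ereal"
  assumes h: "proper_fun h" "convex_fun h"
    and diff: "(\<lambda>y. real_of_ereal (h y)) differentiable (at x)"
    and xy: "x \<in> edom h" "y \<in> edom h"
  shows "real_of_ereal (h x) + inner (grad h x) (y - x) \<le> real_of_ereal (h y)"
proof -
  let ?r = "\<lambda>y. real_of_ereal (h y)"
  have "(?r has_derivative (\<lambda>v. inner v (grad h x))) (at x)"
    using GDERIV_grad[OF diff] by (simp add: gderiv_def)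
  then have "((\<lambda>t. ?r (x + t *\<^sub>R (y - x))) has_derivative (\<lambda>t. inner (t *\<^sub>R (y - x)) (grad h x))) (at 0)"
    by (intro has_derivative_compose[where f = "\<lambda>t. x + t *\<^sub>R (y - x)", where g = ?r])
       (auto intro!: derivative_eq_intros)
  then have "((\<lambda>t. ?r (x + t *\<^sub>R (y - x))) has_real_derivative inner (y - x) (grad h x)) (at 0)"
    by (simp add: has_field_derivative_def mult.commute[of _ "inner _ _"])
  then have "((\<lambda>t. (?r (x + t *\<^sub>R (y - x)) - ?r x) / t) \<longlongrightarrow> inner (y - x) (grad h x)) (at 0)"
    by (simp add: DERIV_def)
  then have lim: "((\<lambda>t. (?r (x + t *\<^sub>R (y - x)) - ?r x) / t) \<longlongrightarrow> inner (y - x) (grad h x)) (at_right 0)"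
    by (rule tendsto_within_subset) simp
  have "(?r (x + t *\<^sub>R (y - x)) - ?r x) / t \<le> ?r y - ?r x" if t: "0 < t" "t < 1" for t
  proof -
    have "x + t *\<^sub>R (y - x) = (1 - t) *\<^sub>R x + t *\<^sub>R y" by (simp add: algebra_simps)
    then have "?r (x + t *\<^sub>R (y - x)) \<le> (1 - t) * ?r x + t * ?r y"
      using convex_fun_real(2)[OF h xy, of t] t by simp
    then show ?thesis using t by (simp add: field_simps)
  qed
  then have "\<forall>\<^sub>F t in at_right 0. (?r (x + t *\<^sub>R (y - x)) - ?r x) / t \<le> ?r y - ?r x"
    unfolding eventually_at_right_field by (intro exI[of _ 1]) auto
  from tendsto_upperbound[OF lim this] show ?thesis by (simp add: inner_commute)
qed

section \<open>The forward-backward step and the linesearch\<close>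

text \<open>Add the subgradient inequality of g from \<open>J\<close> to \<open>y\<close> and the
  gradient inequalities of f from \<open>x\<close> to \<open>y\<close> and from \<open>J\<close> to
  \<open>x\<close>. The remaining mismatch of gradients is controlled by Cauchy-Schwarz and the
  linesearch test, and \<open>\<delta> \<le> 1 / 2\<close> lets the law of cosines absorb
  it.\<close>

lemma forward_backward_inequality:
  fixes f g :: "'a::{real_inner, complete_space} \<Rightarrow> ereal"
  assumes f: "proper_fun f" "convex_fun f"
    and g: "proper_fun g" "lsc_fun g" "convex_fun g"
    and dom: "edom g \<subseteq> edom f"
    and diff: "\<And>z. z \<in> edom g \<Longrightarrow> (\<lambda>y. real_of_ereal (f y)) differentiable (at z)"
    and x: "x \<in> edom g" and y: "y \<in> edom g" and a: "a > 0" and \<delta>: "\<delta> \<le> 1 / 2"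
    and J_def: "J = fb_step f g x a"
    and ls: "a * norm (grad f J - grad f x) \<le> \<delta> * norm (J - x)"
  shows "J \<in> edom g"
    and "2 * a * ((real_of_ereal (f J) + real_of_ereal (g J)) - (real_of_ereal (f y) + real_of_ereal (g y)))
      \<le> (norm (x - y))\<^sup>2 - (norm (J - y))\<^sup>2"
proof -
  define v where "v = (1 / a) *\<^sub>R (x - a *\<^sub>R grad f x - J)"
  have v: "v \<in> subdifferential g J"
    unfolding v_def J_def fb_step_def by (rule prox_resolvent[OF g a])
  show J: "J \<in> edom g" by (rule subdifferential_edom[OF g(1) v])
  have 1: "real_of_ereal (g J) + inner v (y - J) \<le> real_of_ereal (g y)"
    by (rule subdifferentialD_real[OF g(1) v y])
  have 2: "real_of_ereal (f x) + inner (grad f x) (y - x) \<le> real_of_ereal (f y)"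
    using x y dom by (intro convex_gradient_inequality[OF f diff]) auto
  have 3: "real_of_ereal (f J) + inner (grad f J) (x - J) \<le> real_of_ereal (f x)"
    using x J dom by (intro convex_gradient_inequality[OF f diff]) auto
  have av: "a * inner v (y - J) = inner (x - J) (y - J) - a * inner (grad f x) (y - J)"
    using a by (simp add: v_def inner_diff_left algebra_simps)
  have "inner (grad f J - grad f x) (J - x) \<le> norm (grad f J - grad f x) * norm (J - x)"
    by (rule norm_cauchy_schwarz)
  then have "a * inner (grad f J - grad f x) (J - x) \<le> a * (norm (grad f J - grad f x) * norm (J - x))"
    using a by simp
  also have "\<dots> = (a * norm (grad f J - grad f x)) * norm (J - x)" by simp
  also have "\<dots> \<le> (\<delta> * norm (J - x)) * norm (J - x)"
    using ls by (rule mult_right_mono) simp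
  also have "\<dots> = \<delta> * (norm (J - x))\<^sup>2" by (simp add: power2_eq_square)
  also have "\<dots> \<le> 1 / 2 * (norm (J - x))\<^sup>2" using \<delta> by (rule mult_right_mono) simp
  finally have cs: "2 * (a * inner (grad f J - grad f x) (J - x)) \<le> (norm (J - x))\<^sup>2" by simp
  let ?D = "(real_of_ereal (f J) + real_of_ereal (g J)) - (real_of_ereal (f y) + real_of_ereal (g y))"
  have "?D \<le> - inner v (y - J) - inner (grad f x) (y - x) - inner (grad f J) (x - J)"
    using 1 2 3 by linarith
  then have "a * ?D \<le> a * (- inner v (y - J) - inner (grad f x) (y - x) - inner (grad f J) (x - J))"
    using a by (intro mult_left_mono) auto
  also have "\<dots> = - (a * inner v (y - J)) - a * (inner (grad f x) (y - x) + inner (grad f J) (x - J))"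
    by (simp add: algebra_simps)
  also have "\<dots> = a * inner (grad f J - grad f x) (J - x) - inner (x - J) (y - J)"
    unfolding av by (simp add: algebra_simps inner_diff_left inner_diff_right)
  finally have "a * ?D \<le> a * inner (grad f J - grad f x) (J - x) - inner (x - J) (y - J)" .
  moreover have "(norm (x - y))\<^sup>2 = (norm (J - x))\<^sup>2 + (norm (J - y))\<^sup>2 - 2 * inner (x - J) (y - J)"
    unfolding power2_norm_eq_inner by (simp add: algebra_simps inner_commute)
  ultimately show "2 * a * ?D \<le> (norm (x - y))\<^sup>2 - (norm (J - y))\<^sup>2"
    using cs by linarith
qed

text \<open>Shrinking by \<theta> keeps the stepsize in (0, \<sigma>]; the last claim is the negated
  loop guard.\<close>

lemma linesearch1_SomeD:
  assumes ls: "linesearch1 f g x \<sigma> \<theta> \<delta> = Some a" and \<sigma>: "\<sigma> > 0" and \<theta>: "\<theta> \<in> {0<..<1}"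
  shows "0 < a" "a \<le> \<sigma>"
    and "a * norm (grad f (fb_step f g x a) - grad f x) \<le> \<delta> * norm (fb_step f g x a - x)"
proof -
  have "0 < a \<and> a \<le> \<sigma>"
  proof (rule while_option_rule[OF _ ls[unfolded linesearch1_def], where P = "\<lambda>a. 0 < a \<and> a \<le> \<sigma>"])
    fix s assume s: "0 < s \<and> s \<le> \<sigma>"
    then have "\<theta> * s \<le> 1 * s" using \<theta> by (intro mult_right_mono) auto
    moreover have "0 < \<theta> * s" using s \<theta> by simp
    ultimately show "0 < \<theta> * s \<and> \<theta> * s \<le> \<sigma>" using s by linarith
  qed (use \<sigma> in auto)
  then show "0 < a" "a \<le> \<sigma>" by auto
  show "a * norm (grad f (fb_step f g x a) - grad f x) \<le> \<delta> * norm (fb_step f g x a - x)"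
    using while_option_stop[OF ls[unfolded linesearch1_def]] by simp
qed

section \<open>Nesterov's parameters and the energy step\<close>

text \<open>Each step adds at least 1/2, because the square root is at least
  \<open>2 * t_seq k\<close>.\<close>

lemma t_seq_ge: "t_seq k \<ge> (real k + 2) / 2"
proof (induction k)
  case (Suc k)
  have "2 * t_seq k \<le> sqrt (1 + 4 * (t_seq k)\<^sup>2)"
    by (rule real_le_rsqrt) (simp add: power_mult_distrib)
  with Suc show ?case by simp
qed simp

text \<open>The recursion picks the positive root of this quadratic equation, which is what matches
  the weights of consecutive energies.\<close>

lemma t_seq_Suc_square: "(t_seq (Suc k))\<^sup>2 - t_seq (Suc k) = (t_seq k)\<^sup>2"
proof -
  have "(sqrt (1 + 4 * (t_seq k)\<^sup>2))\<^sup>2 = 1 + 4 * (t_seq k)\<^sup>2"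
    by (simp add: add_nonneg_nonneg)
  then show ?thesis by (simp add: power2_eq_square field_simps)
qed

text \<open>One step of Nesterov's scheme: the forward-backward inequality is applied with the convex
  combination \<open>z\<close> of \<open>xk\<close> and the minimizer \<open>xs\<close>, weighted so that \<open>t *\<^sub>R (y - z)\<close> and
  \<open>t *\<^sub>R (x' - z)\<close> become consecutive values of \<open>u\<close>.\<close>

lemma nesterov_step:
  fixes xk xs x0 x' y :: "'a::real_inner" and F :: "'a \<Rightarrow> real"
  assumes t: "t \<ge> 1" "t\<^sup>2 - t = s\<^sup>2" and a: "a \<ge> 0"
    and y: "y = xk + ((s - 1) / t) *\<^sub>R (xk - x0)"
    and z: "z = (1 - 1 / t) *\<^sub>R xk + (1 / t) *\<^sub>R xs"
    and fb: "2 * a * (F x' - F z) \<le> (norm (y - z))\<^sup>2 - (norm (x' - z))\<^sup>2"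
    and Fz: "F z \<le> (1 - 1 / t) * F xk + (1 / t) * F xs"
    and u: "u = s *\<^sub>R xk - (s - 1) *\<^sub>R x0 - xs" and u': "u' = t *\<^sub>R x' - (t - 1) *\<^sub>R xk - xs"
  shows "(norm u')\<^sup>2 + 2 * a * t\<^sup>2 * (F x' - F xs) \<le> (norm u)\<^sup>2 + 2 * a * s\<^sup>2 * (F xk - F xs)"
proof -
  have tz: "t *\<^sub>R z = (t - 1) *\<^sub>R xk + xs"
    using t by (simp add: z scaleR_add_right right_diff_distrib)
  have "t *\<^sub>R (y - z) = u"
    using t by (simp add: scaleR_diff_right tz y u scaleR_add_right)
      (simp add: algebra_simps)
  then have "(norm u)\<^sup>2 = t\<^sup>2 * (norm (y - z))\<^sup>2"
    by (metis norm_scaleR power2_abs power_mult_distrib)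
  moreover have "t *\<^sub>R (x' - z) = u'"
    by (simp add: scaleR_diff_right tz u')
  then have "(norm u')\<^sup>2 = t\<^sup>2 * (norm (x' - z))\<^sup>2"
    by (metis norm_scaleR power2_abs power_mult_distrib)
  moreover have "t\<^sup>2 * (2 * a * (F x' - F z)) \<le> t\<^sup>2 * ((norm (y - z))\<^sup>2 - (norm (x' - z))\<^sup>2)"
    using fb by (rule mult_left_mono) simp
  \<comment> \<open>By \<open>t\<^sup>2 - t = s\<^sup>2\<close>, scaling convexity at
    \<open>z\<close> produces exactly the weights of the two energies.\<close>
  moreover have "t\<^sup>2 * F z \<le> s\<^sup>2 * F xk + (t\<^sup>2 - s\<^sup>2) * F xs"
  proof -
    have "t\<^sup>2 * F z \<le> t\<^sup>2 * ((1 - 1 / t) * F xk + (1 / t) * F xs)"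
      using Fz by (rule mult_left_mono) simp
    also have "\<dots> = (t\<^sup>2 - t) * F xk + t * F xs"
      using t(1) by (simp add: power2_eq_square field_simps)
    also have "\<dots> = s\<^sup>2 * F xk + (t\<^sup>2 - s\<^sup>2) * F xs"
      by (simp flip: t(2))
    finally show ?thesis .
  qed
  then have "2 * a * (t\<^sup>2 * F z) \<le> 2 * a * (s\<^sup>2 * F xk + (t\<^sup>2 - s\<^sup>2) * F xs)"
    using a by (intro mult_left_mono) auto
  ultimately show ?thesis by (simp add: algebra_simps)
qed

section \<open>The convergence rate\<close>

lemma minimizers_INF:
  fixes h :: "'a \<Rightarrow> ereal"
  assumes "p \<in> minimizers h"
  shows "(INF z. h z) = h p"
  using assms by (intro antisym INF_lower INF_greatest) (auto simp: minimizers_def)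

theorem theorem4p10:
  fixes f g :: "'a::{real_inner, complete_space} \<Rightarrow> ereal"
    and x :: "nat \<Rightarrow> 'a" and \<alpha> :: "nat \<Rightarrow> real"
    and \<sigma> \<theta> \<delta> \<alpha>0 :: real
  assumes f: "proper_fun f" "lsc_fun f" "convex_fun f"
    and g: "proper_fun g" "lsc_fun g" "convex_fun g"
    and dom: "edom g \<subseteq> edom f"
    and diff: "\<exists>U. edom g \<subseteq> U \<and> frechet_differentiable_on f U"
    and grad_ucont: "\<And>B. B \<subseteq> edom g \<Longrightarrow> bounded B \<Longrightarrow> uniformly_continuous_on B (grad f)"
    and grad_bdd: "\<And>B. B \<subseteq> edom g \<Longrightarrow> bounded B \<Longrightarrow> bounded (grad f ` B)"
    and closed_dom: "closed (edom g)"
    and generated: "method3 f g \<sigma> \<theta> \<delta> x \<alpha>"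
    and S_nonempty: "minimizers (\<lambda>z. f z + g z) \<noteq> {}"
    and \<alpha>0: "\<alpha>0 > 0" "\<And>k. \<alpha> k \<ge> \<alpha>0"
  shows "\<forall>x_opt \<in> minimizers (\<lambda>z. f z + g z). \<forall>k.
    (f (x k) + g (x k)) - (INF z. f z + g z)
      \<le> ereal (2 / \<alpha>0) *
          (ereal ((norm (x 0 - x_opt))\<^sup>2)
            + ereal (2 * \<sigma>) * ((f (x 0) + g (x 0)) - (INF z. f z + g z)))
        / ereal ((real k + 1)\<^sup>2)"
proof (intro ballI allI)
  fix xs k assume xs: "xs \<in> minimizers (\<lambda>z. f z + g z)"
  let ?G = "edom g"
  define F where "F = (\<lambda>z. real_of_ereal (f z) + real_of_ereal (g z))"
  have F: "f z + g z = ereal (F z)" if "z \<in> ?G" for z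
    using proper_fun_ereal_real[OF f(1), of z] proper_fun_ereal_real[OF g(1) that] that dom
    by (metis F_def plus_ereal.simps(1) subsetD)
  have x0: "x 0 \<in> ?G" and \<sigma>: "\<sigma> > 0" and \<theta>: "\<theta> \<in> {0<..<1}" and \<delta>: "\<delta> \<in> {0<..<1/2}"
    using generated by (auto simp: method3_def)
  \<comment> \<open>The stepsize with index k - 1: step k starts its linesearch from it, and the
    energy at k carries it.\<close>
  define \<beta> where "\<beta> = (\<lambda>k. case k of 0 \<Rightarrow> \<sigma> | Suc j \<Rightarrow> \<alpha> j)"
  define w where "w = (\<lambda>k. projection ?G (extrapolated x k))"
  have ls: "linesearch1 f g (w k) (\<beta> k) \<theta> \<delta> = Some (\<alpha> k)"
    and step: "x (Suc k) = fb_step f g (w k) (\<alpha> k)" for k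
    using generated by (auto simp: method3_def Let_def w_def \<beta>_def)
  have \<alpha>_pos: "\<alpha> k > 0" for k using \<alpha>0 order_less_le_trans by blast
  have \<beta>_pos: "\<beta> k > 0" for k using \<alpha>_pos \<sigma> by (simp add: \<beta>_def split: nat.split)
  have \<alpha>\<beta>: "\<alpha> k \<le> \<beta> k" for k by (rule linesearch1_SomeD(2)[OF ls \<beta>_pos \<theta>])
  \<comment> \<open>For k = 0 this bounds the initial \<sigma> from below, through the first
    accepted stepsize.\<close>
  have \<beta>_ge: "\<alpha>0 \<le> \<beta> k" for k using \<alpha>0(2)[of k] \<alpha>\<beta>[of k] by simp
  have conv: "convex ?G" by (rule convex_edom[OF g(1,3)])
  \<comment> \<open>Extrapolation may leave the domain; projection returns to it, where f is
    differentiable.\<close>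
  have wG: "w k \<in> ?G" for k
    unfolding w_def using closed_dom conv x0 by (intro projection_variational(1)) auto
  have diff': "(\<lambda>y. real_of_ereal (f y)) differentiable (at z)" if "z \<in> ?G" for z
    using diff that unfolding frechet_differentiable_on_def by blast
  \<comment> \<open>The fold states the linesearch test for \<open>x (Suc k)\<close>. The comparison
    point stays open: it is \<open>x 0\<close> for membership and a convex combination for the
    energy.\<close>
  note fb = forward_backward_inequality[OF f(1,3) g dom diff' wG _ \<alpha>_pos _ step
      linesearch1_SomeD(3)[OF ls \<beta>_pos \<theta>, folded step]]
  have xG: "x k \<in> ?G" for k
  proof (cases k)
    case (Suc j)
    show ?thesis unfolding Suc by (rule fb(1)[OF _ x0]) (use \<delta> in auto)
  qed (simp add: x0)
  have xs_min: "f xs + g xs \<le> f z + g z" for z using xs by (simp add: minimizers_def)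
  \<comment> \<open>Minimality against \<open>x 0\<close>, where the objective is finite.\<close>
  have "f xs + g xs \<noteq> \<infinity>" using xs_min[of "x 0"] F[OF x0] by auto
  then have xsG: "xs \<in> ?G" using f(1) by (auto simp: edom_def proper_fun_def)
  have gap: "F xs \<le> F z" if "z \<in> ?G" for z using xs_min[of z] F[OF that] F[OF xsG] by simp
  have INF: "(INF z. f z + g z) = ereal (F xs)" using minimizers_INF[OF xs] F[OF xsG] by simp
  \<comment> \<open>The previous iterate, with \<open>x 0\<close> standing in for index -1.\<close>
  define x' where "x' = (\<lambda>k. case k of 0 \<Rightarrow> x 0 | Suc j \<Rightarrow> x j)"
  define u where "u = (\<lambda>k. t_seq k *\<^sub>R x k - (t_seq k - 1) *\<^sub>R x' k - xs)"
  define C where "C = (norm (x 0 - xs))\<^sup>2 + 2 * \<sigma> * (F (x 0) - F xs)"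
  have energy: "(norm (u k))\<^sup>2 + 2 * \<beta> k * (t_seq k)\<^sup>2 * (F (x k) - F xs) \<le> C" for k
  proof (induction k)
    case 0
    \<comment> \<open>As \<open>t_seq 0 = 1\<close>, the term with \<open>x' 0\<close> vanishes and
      both sides agree.\<close>
    show ?case by (simp add: u_def \<beta>_def C_def)
  next
    case (Suc k)
    define t where "t = t_seq (Suc k)"
    have t: "t \<ge> 1" using t_seq_ge[of "Suc k"] by (simp add: t_def)
    define z where "z = (1 - 1 / t) *\<^sub>R x k + (1 / t) *\<^sub>R xs"
    have inv_t: "0 \<le> 1 / t" "1 / t \<le> 1" using t by auto
    have zG: "z \<in> ?G"
      unfolding z_def by (rule convex_fun_real(1)[OF g(1,3) xG xsG inv_t])
    have Fz: "F z \<le> (1 - 1 / t) * F (x k) + (1 / t) * F xs"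
      using convex_fun_real(2)[OF g(1,3) xG[of k] xsG inv_t]
        convex_fun_real(2)[OF f(1,3) subsetD[OF dom xG[of k]] subsetD[OF dom xsG] inv_t]
      by (simp only: F_def z_def distrib_left)
    have "2 * \<alpha> k * (F (x (Suc k)) - F z) \<le> (norm (w k - z))\<^sup>2 - (norm (x (Suc k) - z))\<^sup>2"
      unfolding F_def by (rule fb(2)[OF _ zG]) (use \<delta> in auto)
    moreover have "norm (w k - z) \<le> norm (extrapolated x k - z)"
      unfolding w_def by (rule norm_projection_diff_le[OF closed_dom conv zG])
    then have "(norm (w k - z))\<^sup>2 \<le> (norm (extrapolated x k - z))\<^sup>2" by (simp add: power_mono)
    ultimately have main: "2 * \<alpha> k * (F (x (Suc k)) - F z)
        \<le> (norm (extrapolated x k - z))\<^sup>2 - (norm (x (Suc k) - z))\<^sup>2" by linarith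
    have "(norm (u (Suc k)))\<^sup>2 + 2 * \<alpha> k * t\<^sup>2 * (F (x (Suc k)) - F xs)
        \<le> (norm (u k))\<^sup>2 + 2 * \<alpha> k * (t_seq k)\<^sup>2 * (F (x k) - F xs)"
    proof (rule nesterov_step[OF t _ _ _ z_def main Fz])
      show "t\<^sup>2 - t = (t_seq k)\<^sup>2" unfolding t_def by (rule t_seq_Suc_square)
      show "0 \<le> \<alpha> k" using \<alpha>_pos[of k] by simp
      show "extrapolated x k = x k + ((t_seq k - 1) / t) *\<^sub>R (x k - x' k)"
        by (simp add: extrapolated_def t_def x'_def)
      show "u k = t_seq k *\<^sub>R x k - (t_seq k - 1) *\<^sub>R x' k - xs" by (simp add: u_def)
      show "u (Suc k) = t *\<^sub>R x (Suc k) - (t - 1) *\<^sub>R x k - xs" by (simp add: u_def t_def x'_def)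
    qed
    \<comment> \<open>Nonincreasing stepsizes and a nonnegative gap allow the weight
      \<open>\<alpha> k\<close> to be replaced by the \<open>\<beta> k\<close> of the induction
      hypothesis.\<close>
    moreover have "2 * \<alpha> k * (t_seq k)\<^sup>2 * (F (x k) - F xs) \<le> 2 * \<beta> k * (t_seq k)\<^sup>2 * (F (x k) - F xs)"
      using \<alpha>\<beta>[of k] gap[OF xG, of k] by (intro mult_right_mono) auto
    moreover have "\<beta> (Suc k) = \<alpha> k" by (simp add: \<beta>_def)
    ultimately show ?case using Suc unfolding t_def by simp
  qed
  let ?v = "F (x k) - F xs"
  have v: "?v \<ge> 0" using gap[OF xG, of k] by simp
  \<comment> \<open>The bound (k + 2)/2 is relaxed to (k + 1)/2; the resulting factor
    \<open>2 * \<alpha>0 / 4\<close> becomes the constant \<open>2 / \<alpha>0\<close>.\<close>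
  have "((real k + 1) / 2)\<^sup>2 \<le> (t_seq k)\<^sup>2" using t_seq_ge[of k] by (intro power_mono) auto
  then have "2 * \<alpha>0 * ((real k + 1) / 2)\<^sup>2 * ?v \<le> 2 * \<beta> k * (t_seq k)\<^sup>2 * ?v"
    using \<beta>_ge[of k] \<alpha>0(1) v by (intro mult_right_mono mult_mono) auto
  also have "\<dots> \<le> C" using energy[of k] zero_le_power2[of "norm (u k)"] by linarith
  finally have "?v \<le> 2 / \<alpha>0 * C / (real k + 1)\<^sup>2"
    using \<alpha>0(1) by (simp add: field_simps power_divide)
  \<comment> \<open>All values of the objective here are finite, so the extended-real claim reduces
    to the real one.\<close>
  then show "(f (x k) + g (x k)) - (INF z. f z + g z)
      \<le> ereal (2 / \<alpha>0) *
          (ereal ((norm (x 0 - xs))\<^sup>2)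
            + ereal (2 * \<sigma>) * ((f (x 0) + g (x 0)) - (INF z. f z + g z)))
        / ereal ((real k + 1)\<^sup>2)"
    unfolding INF F[OF xG] by (simp add: C_def)
qed

end
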